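(* Let $G_{k,l}=P_k\,\square\,P_l$ be the $k\times l$ grid graph. If $k$ or $l$ is even, then $G_{k,l}$ has a canonical ESD labeling.
   Context: $P_k\,\square\,P_l$ denotes the Cartesian product of the paths on $k$ and $l$ vertices. For a graph $G=(V,E)$ and $m\in\mathbb N$, a vertex labeling $\phi:V\to\{1,\dots,m\}$ is an edge-sum distinguishing (ESD) labeling if $\phi$ is injective and the edge-weights $w_\phi(uv)=\phi(u)+\phi(v)$ are pairwise distinct over all edges $uv\in E$. It is a canonical ESD labeling if $m=|V|$. *)

theory Defs
  imports Main
begin

record 'a ugraph =
  verts :: "'a set"
  edges :: "'a set set"

definition simple_graph :: "'a ugraph \<Rightarrow> bool" where
  "simple_graph G \<longleftrightarrow> finite (verts G) \<and> (\<forall>e\<in>edges G. e \<subseteq> verts G \<and> card e = 2)"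

definition path_graph :: "nat \<Rightarrow> nat ugraph" where
  "path_graph k = \<lparr>verts = {..<k}, edges = {{i, Suc i} | i. Suc i < k}\<rparr>"

definition cartesian_product :: "'a ugraph \<Rightarrow> 'b ugraph \<Rightarrow> ('a \<times> 'b) ugraph" where
  "cartesian_product G H =
     \<lparr>verts = verts G \<times> verts H,
      edges = {{(u, v), (u, v')} | u v v'. u \<in> verts G \<and> {v, v'} \<in> edges H}
            \<union> {{(u, v), (u', v)} | u u' v. {u, u'} \<in> edges G \<and> v \<in> verts H}\<rparr>"

definition grid_graph :: "nat \<Rightarrow> nat \<Rightarrow> (nat \<times> nat) ugraph" where
  "grid_graph k l = cartesian_product (path_graph k) (path_graph l)"

(* Edges are two-element sets, so the sum over the edge has exactly two summands. *)
definition edge_weight :: "('a \<Rightarrow> nat) \<Rightarrow> 'a set \<Rightarrow> nat" where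
  "edge_weight \<phi> e = (\<Sum>v\<in>e. \<phi> v)"

definition esd_labeling :: "'a ugraph \<Rightarrow> nat \<Rightarrow> ('a \<Rightarrow> nat) \<Rightarrow> bool" where
  "esd_labeling G m \<phi> \<longleftrightarrow>
     \<phi> ` verts G \<subseteq> {1..m} \<and> inj_on \<phi> (verts G) \<and> inj_on (edge_weight \<phi>) (edges G)"

definition canonical_esd_labeling :: "'a ugraph \<Rightarrow> ('a \<Rightarrow> nat) \<Rightarrow> bool" where
  "canonical_esd_labeling G \<phi> \<longleftrightarrow> esd_labeling G (card (verts G)) \<phi>"

lemma edge_weight_pair: "u \<noteq> v \<Longrightarrow> edge_weight \<phi> {u, v} = \<phi> u + \<phi> v"
  by (simp add: edge_weight_def)

lemma simple_graph_path: "simple_graph (path_graph k)"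
  by (auto simp: simple_graph_def path_graph_def)

lemma simple_graph_cartesian_product:
  assumes "simple_graph G" "simple_graph H"
  shows "simple_graph (cartesian_product G H)"
proof -
  have G: "u \<in> verts G \<and> u' \<in> verts G \<and> u \<noteq> u'" if "{u, u'} \<in> edges G" for u u'
    using assms(1) that by (force simp: simple_graph_def card_2_iff doubleton_eq_iff)
  have H: "v \<in> verts H \<and> v' \<in> verts H \<and> v \<noteq> v'" if "{v, v'} \<in> edges H" for v v'
    using assms(2) that by (force simp: simple_graph_def card_2_iff doubleton_eq_iff)
  have "finite (verts G)" "finite (verts H)"
    using assms by (simp_all add: simple_graph_def)
  then show ?thesis
    by (auto simp: simple_graph_def cartesian_product_def dest: G H)
qed

lemma simple_graph_grid: "simple_graph (grid_graph k l)"
  by (simp add: grid_graph_def simple_graph_cartesian_product simple_graph_path)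

end

theory Submission
  imports Defs
begin

text \<open>
  For even \<open>l\<close>, number the grid row by row. An edge inside a row joins consecutive labels and has
  odd weight, an edge between rows joins labels differing by \<open>l\<close> and has even weight; within each
  class the weight determines the smaller label, hence the edge. The case of even \<open>k\<close> follows by
  transposition.
\<close>

lemma verts_grid_graph: "verts (grid_graph k l) = {..<k} \<times> {..<l}"
  by (simp add: grid_graph_def cartesian_product_def path_graph_def)

text \<open>Listing every edge with its smaller endpoint first makes it determined by that endpoint
  and a direction, which is the form the weight computations need.\<close>

lemma edges_grid_graph:
  "edges (grid_graph k l) =
     {{(i, j), (i, Suc j)} | i j. i < k \<and> Suc j < l} \<union>
     {{(i, j), (Suc i, j)} | i j. Suc i < k \<and> j < l}"
    (is "_ = ?rows \<union> ?cols")
proof (intro equalityI subsetI)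
  fix e assume "e \<in> edges (grid_graph k l)"
  \<comment> \<open>A path edge is only known as an unordered pair, so each case still hides two
    orientations; \<open>doubleton_eq_iff\<close> splits them.\<close>
  then consider
      u v v' i where "e = {(u, v), (u, v')}" "u < k" "{v, v'} = {i, Suc i}" "Suc i < l"
    | u u' v i where "e = {(u, v), (u', v)}" "v < l" "{u, u'} = {i, Suc i}" "Suc i < k"
    unfolding grid_graph_def cartesian_product_def path_graph_def by auto
  then show "e \<in> ?rows \<union> ?cols"
    by cases (auto simp: doubleton_eq_iff)
next
  fix e assume "e \<in> ?rows \<union> ?cols"
  then consider
      i j where "e = {(i, j), (i, Suc j)}" "i < k" "Suc j < l"
    | i j where "e = {(i, j), (Suc i, j)}" "Suc i < k" "j < l"
    by blast
  then show "e \<in> edges (grid_graph k l)"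
  proof cases
    case (1 i j)
    then have "i \<in> {..<k}" "{j, Suc j} \<in> {{j, Suc j} |j. Suc j < l}" by auto
    with 1(1) show ?thesis
      unfolding grid_graph_def cartesian_product_def path_graph_def ugraph.simps by (intro UnI1) blast
  next
    case (2 i j)
    then have "{i, Suc i} \<in> {{i, Suc i} |i. Suc i < k}" "j \<in> {..<l}" by auto
    with 2(1) show ?thesis
      unfolding grid_graph_def cartesian_product_def path_graph_def ugraph.simps by (intro UnI2) blast
  qed
qed

lemma grid_edge_cases [consumes 1, case_names row col]:
  assumes "e \<in> edges (grid_graph k l)"
  obtains i j where "e = {(i, j), (i, Suc j)}" "i < k" "Suc j < l"
    | i j where "e = {(i, j), (Suc i, j)}" "Suc i < k" "j < l"
  using assms unfolding edges_grid_graph by blast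

text \<open>Reindexing of the sum along \<open>f\<close>; injectivity keeps endpoints from merging.
  It serves to transport weights along the transposition.\<close>

lemma edge_weight_image:
  "inj f \<Longrightarrow> edge_weight \<phi> (f ` e) = edge_weight (\<phi> \<circ> f) e"
  unfolding edge_weight_def by (simp add: sum.reindex inj_on_subset)

text \<open>Swapping coordinates carries vertices bijectively and edges injectively into the other
  grid, so both injectivity conditions pass through composition with \<open>prod.swap\<close>, and
  the vertex count stays the same.\<close>

lemma canonical_esd_labeling_grid_transpose:
  assumes "canonical_esd_labeling (grid_graph k l) \<phi>"
  shows "canonical_esd_labeling (grid_graph l k) (\<phi> \<circ> prod.swap)"
proof -
  have verts: "verts (grid_graph k l) = prod.swap ` verts (grid_graph l k)"
    by (simp add: verts_grid_graph product_swap)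
  have "(`) prod.swap e \<in> edges (grid_graph k l)" if "e \<in> edges (grid_graph l k)" for e
    using that by (auto simp: edges_grid_graph)
  then have edges: "(`) prod.swap ` edges (grid_graph l k) \<subseteq> edges (grid_graph k l)"
    by blast
  have inj: "inj_on ((`) prod.swap) (edges (grid_graph l k))"
    by (metis inj_image_eq_iff inj_onI inj_swap)
  have "inj_on \<phi> (prod.swap ` verts (grid_graph l k))"
    and weight: "inj_on (edge_weight \<phi>) (edges (grid_graph k l))"
    using assms by (simp_all add: canonical_esd_labeling_def esd_labeling_def verts)
  then have "inj_on (\<phi> \<circ> prod.swap) (verts (grid_graph l k))"
    by (intro comp_inj_on) simp_all
  moreover have "inj_on (edge_weight \<phi> \<circ> (`) prod.swap) (edges (grid_graph l k))"
    by (rule comp_inj_on[OF inj inj_on_subset[OF weight edges]])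
  moreover have "edge_weight \<phi> \<circ> (`) prod.swap = edge_weight (\<phi> \<circ> prod.swap)"
    by (simp add: fun_eq_iff edge_weight_image)
  ultimately show ?thesis
    using assms unfolding canonical_esd_labeling_def esd_labeling_def verts
    by (simp add: image_comp card_image)
qed

text \<open>Uniqueness of quotient and remainder on division by \<open>l\<close>.\<close>

lemma row_major_inj:
  fixes i j i' j' l :: nat
  assumes "i * l + j = i' * l + j'" "j < l" "j' < l"
  shows "i = i' \<and> j = j'"
proof -
  have "i = (i * l + j) div l" "i' = (i' * l + j') div l"
    using assms(2,3) by simp_all
  with assms(1) show ?thesis by simp
qed

lemma canonical_esd_labeling_row_major:
  assumes "even l"
  shows "canonical_esd_labeling (grid_graph k l) (\<lambda>(i, j). Suc (i * l + j))"
    (is "canonical_esd_labeling _ ?\<phi>")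
proof -
  have range: "i * l + j < k * l" if "i < k" "j < l" for i j
  proof -
    \<comment> \<open>Row \<open>i\<close> ends before \<open>Suc i * l\<close>, where the next row
      starts. The strict bound by \<open>k * l\<close> leaves room for the \<open>Suc\<close> in the
      label.\<close>
    have "i * l + j < Suc i * l" using that by simp
    also have "\<dots> \<le> k * l" using that by (intro mult_le_mono1) simp
    finally show ?thesis .
  qed
  have inj: "inj_on ?\<phi> ({..<k} \<times> {..<l})"
    by (rule inj_onI) (auto dest: row_major_inj)
  \<comment> \<open>Both labels carry a \<open>Suc\<close>, contributing 2; the step to the other
    endpoint adds 1 here and \<open>l\<close> for a column edge.\<close>
  have row_weight: "edge_weight ?\<phi> {(i, j), (i, Suc j)} = 2 * (i * l + j) + 3" for i j
    by (simp add: edge_weight_pair)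
  have col_weight: "edge_weight ?\<phi> {(i, j), (Suc i, j)} = 2 * (i * l + j) + l + 2" for i j
    by (simp add: edge_weight_pair)
  \<comment> \<open>The evenness of \<open>l\<close> enters here: it makes the right side even
    against an odd left side, so no row edge shares a weight with a column edge.\<close>
  have parity: "2 * m + 3 \<noteq> 2 * n + l + 2" for m n
  proof
    assume "2 * m + 3 = 2 * n + l + 2"
    then have "even (2 * m + 3) \<longleftrightarrow> even (2 * n + l + 2)" by (rule arg_cong)
    with assms show False by simp
  qed
  have "inj_on (edge_weight ?\<phi>) (edges (grid_graph k l))"
  proof (rule inj_onI)
    fix e e'
    assume e: "e \<in> edges (grid_graph k l)" and e': "e' \<in> edges (grid_graph k l)"
      and eq: "edge_weight ?\<phi> e = edge_weight ?\<phi> e'"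
    show "e = e'"
      using e
    proof (cases rule: grid_edge_cases)
      case row: (row i j)
      show ?thesis
        using e'
      proof (cases rule: grid_edge_cases)
        case row': (row i' j')
        have "i * l + j = i' * l + j'"
          using eq unfolding row(1) row'(1) row_weight by simp
        with row row' show ?thesis using row_major_inj[of i l j i' j'] by simp
      next
        case col': (col i' j')
        show ?thesis
          using eq parity unfolding row(1) col'(1) row_weight col_weight by blast
      qed
    next
      case col: (col i j)
      show ?thesis
        using e'
      proof (cases rule: grid_edge_cases)
        case row': (row i' j')
        show ?thesis
          using eq[symmetric] parity unfolding col(1) row'(1) row_weight col_weight by blast
      next
        case col': (col i' j')
        have "i * l + j = i' * l + j'"
          using eq unfolding col(1) col'(1) col_weight by simp
        with col col' show ?thesis using row_major_inj[of i l j i' j'] by simp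
      qed
    qed
  qed
  with inj range show ?thesis
    by (auto simp: canonical_esd_labeling_def esd_labeling_def verts_grid_graph Suc_le_eq)
qed

theorem theorem9:
  fixes k l :: nat
  assumes "k \<ge> 1" and "l \<ge> 1"
    and "even k \<or> even l"
  shows "\<exists>\<phi>. canonical_esd_labeling (grid_graph k l) \<phi>"
  using assms(3) canonical_esd_labeling_row_major canonical_esd_labeling_grid_transpose by blast

end
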